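(* Let $\mathbb{R}^2$ carry the standard coordinates $(x,y)$ and the Euclidean metric $ds^2=dx^2+dy^2$. Let $a\neq0$ be a real constant and let $N$ be the helicoid with parametrization $\vec r(u,v)=(u\cos v,u\sin v,av)$, $(u,v)\in\mathbb{R}^2$, and the metric induced from $\mathbb{R}^3$. Let $f:\mathbb{R}\to\mathbb{R}$ be smooth. Then the map $\phi:\mathbb{R}^2\to N$ given in the coordinates $(u,v)$ by $\phi(x,y)=(f(x),y)$ is biharmonic if and only if $f(x)=(A+Bx)e^x+(C+Dx)e^{-x}$ for some real constants $A,B,C,D$. It is proper biharmonic when $B^2+D^2\neq0$.
   Context: For a smooth map $\phi:(M,g)\to(N,h)$ between Riemannian manifolds the tension field is $\tau(\phi)=\mathrm{Trace}_g\nabla d\phi$; $\phi$ is harmonic if $\tau(\phi)=0$. It is biharmonic if it is a critical point of $\frac12\int_\Omega|\tau(\phi)|^2v_g$ for every compact $\Omega\subset M$, equivalently if $$\tau^2(\phi)=\mathrm{Trace}_g\big(\nabla^\phi\nabla^\phi-\nabla^\phi_{\nabla^M}\big)\tau(\phi)-\mathrm{Trace}_g R^N(d\phi,\tau(\phi))\,d\phi=0,$$ with $R^N(X,Y)Z=[\nabla^N_X,\nabla^N_Y]Z-\nabla^N_{[X,Y]}Z$. A biharmonic map is proper if it is not harmonic. *)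

theory Defs
  imports "HOL-Analysis.Analysis"
begin

text \<open>
  Riemannian manifolds are described in a global chart \<^typ>\<open>real^'n\<close>: a metric is given by its Gram
  matrices, and vector fields, maps and vector fields along maps by their component functions.
  The operators below have their intended meaning for smooth arguments.
\<close>

type_synonym 'n metric = "real^'n \<Rightarrow> real^'n^'n"

abbreviation differential :: "(real^'m \<Rightarrow> real^'n) \<Rightarrow> real^'m \<Rightarrow> real^'m \<Rightarrow> real^'n"
  where "differential F p \<equiv> frechet_derivative F (at p)"

definition coord_field :: "'n::finite \<Rightarrow> real^'n \<Rightarrow> real^'n"
  where "coord_field i = (\<lambda>_. axis i 1)"

definition standard_metric :: "'n::finite metric"
  where "standard_metric = (\<lambda>_. mat 1)"

definition induced_metric :: "(real^'n \<Rightarrow> real^'k) \<Rightarrow> 'n::finite metric"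
  where "induced_metric r p =
    (\<chi> i j. differential r p (axis i 1) \<bullet> differential r p (axis j 1))"

definition metric_deriv :: "'n::finite metric \<Rightarrow> real^'n \<Rightarrow> 'n \<Rightarrow> 'n \<Rightarrow> 'n \<Rightarrow> real"
  where "metric_deriv g p l i j = frechet_derivative (\<lambda>q. g q $ i $ j) (at p) (axis l 1)"

definition christoffel :: "'n::finite metric \<Rightarrow> real^'n \<Rightarrow> 'n \<Rightarrow> 'n \<Rightarrow> 'n \<Rightarrow> real"
  where "christoffel g p k i j = (\<Sum>l\<in>UNIV. matrix_inv (g p) $ k $ l *
    (metric_deriv g p i j l + metric_deriv g p j i l - metric_deriv g p l i j)) / 2"

definition christoffel_form :: "'n::finite metric \<Rightarrow> real^'n \<Rightarrow> real^'n \<Rightarrow> real^'n \<Rightarrow> real^'n"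
  where "christoffel_form g p v w =
    (\<chi> k. \<Sum>i\<in>UNIV. \<Sum>j\<in>UNIV. christoffel g p k i j * v $ i * w $ j)"

text \<open>The derivative of \<^term>\<open>Y\<close> in the direction \<^term>\<open>X\<close>.\<close>

definition levi_civita ::
  "'n::finite metric \<Rightarrow> (real^'n \<Rightarrow> real^'n) \<Rightarrow> (real^'n \<Rightarrow> real^'n) \<Rightarrow> real^'n \<Rightarrow> real^'n"
  where "levi_civita g X Y p = differential Y p (X p) + christoffel_form g p (X p) (Y p)"

definition lie_bracket ::
  "(real^'n \<Rightarrow> real^'n) \<Rightarrow> (real^'n \<Rightarrow> real^'n) \<Rightarrow> real^'n \<Rightarrow> real^'n"
  where "lie_bracket X Y p = differential Y p (X p) - differential X p (Y p)"

definition curvature :: "'n::finite metric \<Rightarrow> (real^'n \<Rightarrow> real^'n) \<Rightarrow> (real^'n \<Rightarrow> real^'n) \<Rightarrow>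
    (real^'n \<Rightarrow> real^'n) \<Rightarrow> real^'n \<Rightarrow> real^'n"
  where "curvature g X Y Z p =
    levi_civita g X (levi_civita g Y Z) p - levi_civita g Y (levi_civita g X Z) p
    - levi_civita g (lie_bracket X Y) Z p"

text \<open>
  The value of the curvature on tangent vectors at \<^term>\<open>p\<close>. By tensoriality the choice of
  extensions to vector fields is irrelevant; those with constant components are used.
\<close>

definition curvature_at ::
  "'n::finite metric \<Rightarrow> real^'n \<Rightarrow> real^'n \<Rightarrow> real^'n \<Rightarrow> real^'n \<Rightarrow> real^'n"
  where "curvature_at g p u v w = curvature g (\<lambda>_. u) (\<lambda>_. v) (\<lambda>_. w) p"

text \<open>The connection induced on the pull-back of the tangent bundle of the target by \<^term>\<open>\<phi>\<close>.\<close>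

definition pullback_connection :: "'n::finite metric \<Rightarrow> (real^'m::finite \<Rightarrow> real^'n) \<Rightarrow>
    (real^'m \<Rightarrow> real^'m) \<Rightarrow> (real^'m \<Rightarrow> real^'n) \<Rightarrow> real^'m \<Rightarrow> real^'n"
  where "pullback_connection h \<phi> X V p =
    differential V p (X p) + christoffel_form h (\<phi> p) (differential \<phi> p (X p)) (V p)"

definition second_fundamental_form :: "'m::finite metric \<Rightarrow> 'n::finite metric \<Rightarrow>
    (real^'m \<Rightarrow> real^'n) \<Rightarrow> (real^'m \<Rightarrow> real^'m) \<Rightarrow> (real^'m \<Rightarrow> real^'m) \<Rightarrow> real^'m \<Rightarrow> real^'n"
  where "second_fundamental_form g h \<phi> X Y p =
    pullback_connection h \<phi> X (\<lambda>q. differential \<phi> q (Y q)) p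
    - differential \<phi> p (levi_civita g X Y p)"

text \<open>Meaningful for tensorial \<^term>\<open>T\<close>, for which coordinate fields suffice.\<close>

definition metric_trace :: "'m::finite metric \<Rightarrow> ((real^'m \<Rightarrow> real^'m) \<Rightarrow> (real^'m \<Rightarrow> real^'m) \<Rightarrow>
    real^'m \<Rightarrow> real^'n) \<Rightarrow> real^'m \<Rightarrow> real^'n::finite"
  where "metric_trace g T p = (\<Sum>i\<in>UNIV. \<Sum>j\<in>UNIV.
    matrix_inv (g p) $ i $ j *\<^sub>R T (coord_field i) (coord_field j) p)"

definition tension :: "'m::finite metric \<Rightarrow> 'n::finite metric \<Rightarrow> (real^'m \<Rightarrow> real^'n) \<Rightarrow>
    real^'m \<Rightarrow> real^'n"
  where "tension g h \<phi> = metric_trace g (second_fundamental_form g h \<phi>)"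

definition bitension :: "'m::finite metric \<Rightarrow> 'n::finite metric \<Rightarrow> (real^'m \<Rightarrow> real^'n) \<Rightarrow>
    real^'m \<Rightarrow> real^'n"
  where "bitension g h \<phi> p =
    metric_trace g (\<lambda>X Y q.
      pullback_connection h \<phi> X (pullback_connection h \<phi> Y (tension g h \<phi>)) q
      - pullback_connection h \<phi> (levi_civita g X Y) (tension g h \<phi>) q) p
    - metric_trace g (\<lambda>X Y q.
        curvature_at h (\<phi> q) (differential \<phi> q (X q)) (tension g h \<phi> q)
          (differential \<phi> q (Y q))) p"

definition harmonic_map ::
  "'m::finite metric \<Rightarrow> 'n::finite metric \<Rightarrow> (real^'m \<Rightarrow> real^'n) \<Rightarrow> bool"
  where "harmonic_map g h \<phi> \<longleftrightarrow> (\<forall>p. tension g h \<phi> p = 0)"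

definition biharmonic_map ::
  "'m::finite metric \<Rightarrow> 'n::finite metric \<Rightarrow> (real^'m \<Rightarrow> real^'n) \<Rightarrow> bool"
  where "biharmonic_map g h \<phi> \<longleftrightarrow> (\<forall>p. bitension g h \<phi> p = 0)"

definition proper_biharmonic_map ::
  "'m::finite metric \<Rightarrow> 'n::finite metric \<Rightarrow> (real^'m \<Rightarrow> real^'n) \<Rightarrow> bool"
  where "proper_biharmonic_map g h \<phi> \<longleftrightarrow> biharmonic_map g h \<phi> \<and> \<not> harmonic_map g h \<phi>"

definition smooth_real :: "(real \<Rightarrow> real) \<Rightarrow> bool"
  where "smooth_real f \<longleftrightarrow> (\<forall>n. (deriv ^^ n) f differentiable_on UNIV)"

definition helicoid :: "real \<Rightarrow> real^2 \<Rightarrow> real^3"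
  where "helicoid a q = vector [q $ 1 * cos (q $ 2), q $ 1 * sin (q $ 2), a * q $ 2]"

text \<open>
  For \<^term>\<open>a \<noteq> 0\<close> the parametrization is an injective immersion, so \<open>(u, v)\<close> are
  global coordinates on the helicoid.
\<close>

lemma inj_helicoid:
  assumes "a \<noteq> 0"
  shows "inj (helicoid a)"
proof (rule injI)
  fix p q assume "helicoid a p = helicoid a q"
  then have *: "p $ 1 * cos (p $ 2) = q $ 1 * cos (q $ 2)"
    "p $ 1 * sin (p $ 2) = q $ 1 * sin (q $ 2)" "p $ 2 = q $ 2"
    using assms by (auto simp: helicoid_def vec_eq_iff forall_3)
  then have "p $ 1 = q $ 1"
    by (metis mult_cancel_right sin_zero_abs_cos_one abs_0 zero_neq_one)
  with * show "p = q"
    by (simp add: vec_eq_iff forall_2)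
qed

lemma helicoid_has_derivative:
  "(helicoid a has_derivative
     (\<lambda>w. vector [w $ 1 * cos (q $ 2) - q $ 1 * sin (q $ 2) * w $ 2,
                  w $ 1 * sin (q $ 2) + q $ 1 * cos (q $ 2) * w $ 2, a * w $ 2])) (at q)"
proof -
  have nth: "((\<lambda>q::real^2. q $ i) has_derivative (\<lambda>w. w $ i)) (at q)" for i
    by (rule bounded_linear_imp_has_derivative[OF bounded_linear_vec_nth])
  have eq: "(vector [x, y, z] :: real^3) = x *\<^sub>R axis 1 1 + y *\<^sub>R axis 2 1 + z *\<^sub>R axis 3 1" for x y z
    by (simp add: vec_eq_iff forall_3 axis_def)
  show ?thesis
    unfolding helicoid_def[abs_def] eq
    by (auto intro!: derivative_eq_intros nth simp: algebra_simps)
qed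

lemma induced_metric_helicoid:
  "induced_metric (helicoid a) q = vector [vector [1, 0], vector [0, (q $ 1)\<^sup>2 + a\<^sup>2]]"
proof -
  have "(q $ 1 * sin (q $ 2))\<^sup>2 + (q $ 1 * cos (q $ 2))\<^sup>2 = (q $ 1)\<^sup>2"
    by (simp add: power_mult_distrib flip: distrib_left)
  then show ?thesis
    by (simp add: induced_metric_def vec_eq_iff forall_2 inner_vec_def sum_3 axis_def
        power2_eq_square algebra_simps flip: frechet_derivative_at[OF helicoid_has_derivative])
qed

end

theory Submission
  imports Defs
begin

text \<open>
  In the coordinates \<open>(u, v)\<close> the helicoid is a surface with metric \<open>du\<^sup>2 + (u\<^sup>2 + a\<^sup>2) dv\<^sup>2\<close>, and the
  maps \<open>(x, y) \<mapsto> (f x, y)\<close> are equivariant under the isometries \<open>y \<mapsto> y + c\<close>, \<open>y \<mapsto> - y\<close> of the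
  plane and \<open>v \<mapsto> v + c\<close>, \<open>v \<mapsto> - v\<close> of the helicoid. Hence their tension field is a multiple of
  \<open>\<partial>\<^sub>u\<close> that depends on \<open>x\<close> only; since \<open>\<nabla>\<^bsub>\<partial>v\<^esub> \<partial>\<^sub>v = - u \<partial>\<^sub>u\<close>, the multiple is \<open>t = f'' - f\<close>
  (lemma \<open>tension_rotational\<close>).

  The nonlinear terms of the bitension field cancel. The second covariant derivative of
  \<open>t \<partial>\<^sub>u\<close> in the direction \<open>y\<close> contributes \<open>- f\<^sup>2 / (f\<^sup>2 + a\<^sup>2) \<cdot> t\<close>, and the Gauss curvature
  \<open>- a\<^sup>2 / (u\<^sup>2 + a\<^sup>2)\<^sup>2\<close> contributes \<open>- a\<^sup>2 / (f\<^sup>2 + a\<^sup>2) \<cdot> t\<close>. Together they give \<open>- t\<close>, so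
  the map is biharmonic exactly when \<open>t'' = t\<close> (lemma \<open>bitension_rotational\<close>).

  This is the linear equation \<open>f - 2 f + f = 0\<close>, which is solved by applying the description of the solutions of \<open>g'' = g\<close> twice. For the solution with constants
  \<open>A, B, C, D\<close> one has \<open>t = 2 B e\<^sup>x - 2 D e\<^sup>-\<^sup>x\<close>, which vanishes identically only
  for \<open>B = D = 0\<close>.
\<close>

section \<open>Vector fields in two components\<close>

lemma has_derivative_vector_2:
  assumes "(F has_derivative F') (at p)" "(G has_derivative G') (at p)"
  shows "((\<lambda>q. vector [F q, G q] :: real^2) has_derivative (\<lambda>w. vector [F' w, G' w])) (at p)"
proof -
  have eq: "(vector [x, y] :: real^2) = x *\<^sub>R axis 1 1 + y *\<^sub>R axis 2 1" for x y
    by (simp add: vec_eq_iff forall_2 axis_def)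
  show ?thesis
    unfolding eq by (auto intro!: derivative_eq_intros assms)
qed

lemma has_derivative_comp_nth:
  fixes p :: "real^'n"
  assumes "(F has_real_derivative d) (at (p $ i))"
  shows "((\<lambda>q. F (q $ i)) has_derivative (\<lambda>w. d * w $ i)) (at p)"
proof -
  have "((\<lambda>q::real^'n. q $ i) has_derivative (\<lambda>w. w $ i)) (at p)"
    by (rule bounded_linear_imp_has_derivative[OF bounded_linear_vec_nth])
  from has_derivative_compose[OF this] assms show ?thesis
    by (simp add: has_field_derivative_def)
qed

lemma has_derivative_vector_2_nth:
  fixes p :: "real^'n"
  assumes "(F has_real_derivative c) (at (p $ i))" "(G has_real_derivative d) (at (p $ j))"
  shows "((\<lambda>q. vector [F (q $ i), G (q $ j)] :: real^2) has_derivative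
          (\<lambda>w. vector [c * w $ i, d * w $ j])) (at p)"
  by (intro has_derivative_vector_2 has_derivative_comp_nth assms)

lemmas differential_eq = frechet_derivative_at[symmetric]

lemma coord_field_nth: "coord_field i p $ j = (if j = i then 1 else 0)"
  by (simp add: coord_field_def axis_def)

section \<open>Euclidean space\<close>

lemma matrix_inv_eqI:
  fixes M N :: "real^'n^'n"
  assumes "M ** N = mat 1"
  shows "matrix_inv M = N"
proof -
  have NM: "N ** M = mat 1"
    using assms matrix_left_right_inverse by blast
  have "matrix_inv M ** M = mat 1"
    unfolding matrix_inv_def using someI[of "\<lambda>N. M ** N = mat 1 \<and> N ** M = mat 1" N] assms NM
    by blast
  then show ?thesis
    by (metis assms matrix_mul_assoc matrix_mul_lid matrix_mul_rid)
qed

lemma metric_trace_standard: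
  fixes T :: "(real^'m \<Rightarrow> real^'m) \<Rightarrow> (real^'m \<Rightarrow> real^'m) \<Rightarrow> real^'m \<Rightarrow> real^'b"
  shows "metric_trace standard_metric T p = (\<Sum>i\<in>UNIV. T (coord_field i) (coord_field i) p)"
proof -
  have "matrix_inv (mat 1 :: real^'m^'m) $ i $ j *\<^sub>R v = (if j = i then v else 0)"
    for i j :: 'm and v :: "real^'b"
    by (simp add: matrix_inv_eqI[of "mat 1" "mat 1"]) (simp add: mat_def)
  then show ?thesis
    by (simp add: metric_trace_def standard_metric_def)
qed

lemma levi_civita_standard_coord_field:
  fixes i j :: "'n::finite"
  shows "levi_civita standard_metric (coord_field i) (coord_field j) = (\<lambda>_. 0)"
proof -
  have "metric_deriv standard_metric p l i j = 0" for p :: "real^'n" and l i j :: 'n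
    by (simp add: metric_deriv_def standard_metric_def)
  then show ?thesis
    by (simp add: fun_eq_iff levi_civita_def coord_field_def christoffel_form_def
        christoffel_def vec_eq_iff)
qed

section \<open>The helicoid\<close>

lemma sum_square_pos: "a \<noteq> 0 \<Longrightarrow> u\<^sup>2 + a\<^sup>2 > 0" for a u :: real
  by (simp add: sum_power2_gt_zero_iff)

lemma induced_metric_helicoid_fun:
  "induced_metric (helicoid a) = (\<lambda>q. vector [vector [1, 0], vector [0, (q $ 1)\<^sup>2 + a\<^sup>2]])"
  by (simp add: fun_eq_iff induced_metric_helicoid)

lemma matrix_inv_helicoid:
  assumes "a \<noteq> 0"
  shows "matrix_inv (induced_metric (helicoid a) p) =
    vector [vector [1, 0], vector [0, 1 / ((p $ 1)\<^sup>2 + a\<^sup>2)]]"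
  by (rule matrix_inv_eqI)
    (use sum_square_pos[OF assms, of "p $ 1"] assms in
      \<open>simp add: induced_metric_helicoid vec_eq_iff forall_2 matrix_matrix_mult_def sum_2 mat_def\<close>)

lemma metric_deriv_helicoid:
  "metric_deriv (induced_metric (helicoid a)) p l i j =
    (if l = 1 \<and> i = 2 \<and> j = 2 then 2 * p $ 1 else 0)"
proof -
  have "((\<lambda>u. u\<^sup>2 + a\<^sup>2) has_real_derivative 2 * p $ 1) (at (p $ 1))"
    by (auto intro!: derivative_eq_intros)
  from differential_eq[OF has_derivative_comp_nth[OF this]]
  have "metric_deriv (induced_metric (helicoid a)) p l 2 2 = 2 * p $ 1 * axis l 1 $ 1"
    by (simp add: metric_deriv_def induced_metric_helicoid_fun)
  then show ?thesis
    using exhaust_2[of i] exhaust_2[of j] exhaust_2[of l]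
    by (auto simp: metric_deriv_def induced_metric_helicoid_fun axis_def)
qed

text \<open>
  The only nonzero Christoffel symbols of \<open>du\<^sup>2 + (u\<^sup>2 + a\<^sup>2) dv\<^sup>2\<close> are
  \<open>\<Gamma>\<^sup>u\<^sub>v\<^sub>v = - u\<close> and \<open>\<Gamma>\<^sup>v\<^sub>u\<^sub>v = \<Gamma>\<^sup>v\<^sub>v\<^sub>u = u / (u\<^sup>2 + a\<^sup>2)\<close>.
\<close>

lemma christoffel_form_helicoid:
  assumes "a \<noteq> 0"
  shows "christoffel_form (induced_metric (helicoid a)) p v w =
    vector [- p $ 1 * (v $ 2 * w $ 2),
            p $ 1 / ((p $ 1)\<^sup>2 + a\<^sup>2) * (v $ 1 * w $ 2 + v $ 2 * w $ 1)]"
  by (simp add: christoffel_form_def christoffel_def matrix_inv_helicoid[OF assms]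
      metric_deriv_helicoid sum_2 vec_eq_iff forall_2 algebra_simps)

lemma levi_civita_helicoid_const:
  assumes "a \<noteq> 0"
  shows "levi_civita (induced_metric (helicoid a)) (\<lambda>_. v) (\<lambda>_. w) =
    (\<lambda>p. vector [- p $ 1 * (v $ 2 * w $ 2),
            p $ 1 / ((p $ 1)\<^sup>2 + a\<^sup>2) * (v $ 1 * w $ 2 + v $ 2 * w $ 1)])"
  by (simp add: fun_eq_iff levi_civita_def christoffel_form_helicoid[OF assms])

lemma has_real_derivative_connection_coefficient:
  fixes a u :: real
  assumes "a \<noteq> 0"
  shows "((\<lambda>u. u / (u\<^sup>2 + a\<^sup>2)) has_real_derivative (a\<^sup>2 - u\<^sup>2) / (u\<^sup>2 + a\<^sup>2)\<^sup>2) (at u)"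
  using sum_square_pos[OF assms, of u]
  by (auto intro!: derivative_eq_intros simp: power2_eq_square)

text \<open>
  Both compositions of covariant derivatives in the curvature of constant fields have this form.
  Here \<open>m v w / 2\<close> is the polarization of the quadratic form \<open>v\<^sub>1 v\<^sub>2\<close>, through which the
  \<open>\<Gamma>\<^sup>v\<close> act.
\<close>

lemma second_covariant_derivative_helicoid_const:
  fixes p :: "real^2"
  assumes "a \<noteq> 0"
  defines "s \<equiv> (p $ 1)\<^sup>2 + a\<^sup>2"
  defines "m \<equiv> \<lambda>v w :: real^2. v $ 1 * w $ 2 + v $ 2 * w $ 1"
  shows "levi_civita (induced_metric (helicoid a)) (\<lambda>_. u)
      (levi_civita (induced_metric (helicoid a)) (\<lambda>_. v) (\<lambda>_. w)) p =
    vector [- u $ 1 * (v $ 2 * w $ 2) - (p $ 1)\<^sup>2 / s * (u $ 2 * m v w),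
            (a\<^sup>2 - (p $ 1)\<^sup>2) / s\<^sup>2 * (u $ 1 * m v w)
             + p $ 1 / s * (u $ 1 * (p $ 1 / s * m v w) - u $ 2 * (p $ 1 * (v $ 2 * w $ 2)))]"
proof -
  let ?V = "levi_civita (induced_metric (helicoid a)) (\<lambda>_. v) (\<lambda>_. w)"
  have 1: "((\<lambda>x. - x * (v $ 2 * w $ 2)) has_real_derivative - (v $ 2 * w $ 2)) (at (p $ 1))"
    by (auto intro!: derivative_eq_intros)
  have 2: "((\<lambda>x. x / (x\<^sup>2 + a\<^sup>2) * m v w) has_real_derivative
      (a\<^sup>2 - (p $ 1)\<^sup>2) / s\<^sup>2 * m v w) (at (p $ 1))"
    using has_real_derivative_connection_coefficient[OF assms(1), of "p $ 1"]
    unfolding s_def by (rule DERIV_cmult_right)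
  have "differential ?V p =
    (\<lambda>w'. vector [- (v $ 2 * w $ 2) * w' $ 1, (a\<^sup>2 - (p $ 1)\<^sup>2) / s\<^sup>2 * m v w * w' $ 1])"
    unfolding levi_civita_helicoid_const[OF assms(1)]
    using differential_eq[OF has_derivative_vector_2_nth[OF 1 2]] by (simp add: m_def)
  then show ?thesis
    unfolding levi_civita_def[of _ _ ?V]
    by (simp add: levi_civita_helicoid_const[OF assms(1)] christoffel_form_helicoid[OF assms(1)]
      vec_eq_iff forall_2 power2_eq_square s_def m_def)
qed

text \<open>
  On a surface \<open>R(X, Y)Z = K (\<langle>Y, Z\<rangle> X - \<langle>X, Z\<rangle> Y)\<close>, and the helicoid has Gauss curvature
  \<open>K = - a\<^sup>2 / (u\<^sup>2 + a\<^sup>2)\<^sup>2\<close>.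
\<close>

lemma curvature_at_helicoid:
  fixes p u v w :: "real^2"
  assumes "a \<noteq> 0"
  defines "s \<equiv> (p $ 1)\<^sup>2 + a\<^sup>2"
  shows "curvature_at (induced_metric (helicoid a)) p u v w =
    (- a\<^sup>2 / s\<^sup>2) *\<^sub>R ((v $ 1 * w $ 1 + s * (v $ 2 * w $ 2)) *\<^sub>R u
                   - (u $ 1 * w $ 1 + s * (u $ 2 * w $ 2)) *\<^sub>R v)"
proof -
  have s: "s > 0" and a2: "a\<^sup>2 = s - (p $ 1)\<^sup>2"
    using sum_square_pos[OF assms(1)] by (simp_all add: s_def)
  have "lie_bracket (\<lambda>_. u) (\<lambda>_. v) = (\<lambda>_. 0)"
    by (simp add: fun_eq_iff lie_bracket_def)
  moreover have "levi_civita (induced_metric (helicoid a)) (\<lambda>_. 0) (\<lambda>_. w) p = 0"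
    by (simp add: levi_civita_helicoid_const[OF assms(1)] vec_eq_iff forall_2)
  ultimately show ?thesis
    unfolding curvature_at_def curvature_def
      second_covariant_derivative_helicoid_const[OF assms(1)] s_def[symmetric]
    using s unfolding a2
    by (simp add: vec_eq_iff forall_2 divide_simps) (simp add: algebra_simps power2_eq_square)
qed

section \<open>Maps that preserve the second coordinate\<close>

lemma differential_rotational:
  fixes p :: "real^2" and \<phi> :: "real^2 \<Rightarrow> real^2"
  assumes \<phi>: "\<phi> = (\<lambda>p. vector [f (p $ 1), p $ 2])"
    and f: "(f has_real_derivative f') (at (p $ 1))"
  shows "differential \<phi> p = (\<lambda>w. vector [f' * w $ 1, w $ 2])"
  using differential_eq[OF has_derivative_vector_2_nth[OF f DERIV_ident]]
  by (simp add: \<phi>)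

text \<open>
  The class of fields whose components depend on \<open>x\<close> only is closed under the pull-back connection
  in coordinate directions, so this formula can be iterated.
\<close>

lemma pullback_connection_rotational:
  fixes p :: "real^2" and \<phi> :: "real^2 \<Rightarrow> real^2"
  assumes "a \<noteq> 0"
    and \<phi>: "\<phi> = (\<lambda>p. vector [f (p $ 1), p $ 2])"
    and f: "(f has_real_derivative f') (at (p $ 1))"
    and P: "(P has_real_derivative P') (at (p $ 1))"
    and Q: "(Q has_real_derivative Q') (at (p $ 1))"
  shows "pullback_connection (induced_metric (helicoid a)) \<phi> X
      (\<lambda>q. vector [P (q $ 1), Q (q $ 1)]) p =
    vector [P' * X p $ 1 - f (p $ 1) * (X p $ 2 * Q (p $ 1)),
            Q' * X p $ 1 + f (p $ 1) / ((f (p $ 1))\<^sup>2 + a\<^sup>2)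
              * (f' * X p $ 1 * Q (p $ 1) + X p $ 2 * P (p $ 1))]"
  using differential_rotational[OF \<phi> f]
    differential_eq[OF has_derivative_vector_2_nth[OF P Q]]
  by (simp add: pullback_connection_def christoffel_form_helicoid[OF assms(1)] \<phi>
      vec_eq_iff forall_2 algebra_simps)

text \<open>The two summands of \<open>f'' - f\<close> come from the directions \<open>x\<close> and \<open>y\<close>, respectively.\<close>

lemma tension_rotational:
  fixes \<phi> :: "real^2 \<Rightarrow> real^2"
  assumes "a \<noteq> 0"
    and \<phi>: "\<phi> = (\<lambda>p. vector [f (p $ 1), p $ 2])"
    and f: "\<And>x. (f has_real_derivative f' x) (at x)"
    and f': "\<And>x. (f' has_real_derivative f'' x) (at x)"
  shows "tension standard_metric (induced_metric (helicoid a)) \<phi> =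
    (\<lambda>p. vector [f'' (p $ 1) - f (p $ 1), 0])"
proof
  fix p :: "real^2"
  have d\<phi>: "differential \<phi> q = (\<lambda>w. vector [f' (q $ 1) * w $ 1, w $ 2])" for q
    by (rule differential_rotational[OF \<phi> f])
  have "second_fundamental_form standard_metric (induced_metric (helicoid a)) \<phi>
      (coord_field 1) (coord_field 1) p = vector [f'' (p $ 1), 0]"
    using pullback_connection_rotational[OF assms(1) \<phi> f f' DERIV_const[of 0], of "coord_field 1" p]
    by (simp add: second_fundamental_form_def levi_civita_standard_coord_field d\<phi> coord_field_nth
        vec_eq_iff forall_2)
  moreover have "second_fundamental_form standard_metric (induced_metric (helicoid a)) \<phi>
      (coord_field 2) (coord_field 2) p = vector [- f (p $ 1), 0]"
    using pullback_connection_rotational[OF assms(1) \<phi> f DERIV_const[of 0] DERIV_const[of 1],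
        of "coord_field 2" p]
    by (simp add: second_fundamental_form_def levi_civita_standard_coord_field d\<phi> coord_field_nth
        vec_eq_iff forall_2)
  ultimately show "tension standard_metric (induced_metric (helicoid a)) \<phi> p =
      vector [f'' (p $ 1) - f (p $ 1), 0]"
    by (simp add: tension_def metric_trace_standard sum_2 vec_eq_iff forall_2)
qed

text \<open>
  Only the direction \<open>y\<close> produces nonlinear terms. There
  \<open>\<nabla>\<^sub>y (t \<partial>\<^sub>u) = f t / (f\<^sup>2 + a\<^sup>2) \<partial>\<^sub>v\<close>, and one more derivative gives
  \<open>- f\<^sup>2 t / (f\<^sup>2 + a\<^sup>2) \<partial>\<^sub>u\<close>, while the curvature term is \<open>R(\<partial>\<^sub>v, t \<partial>\<^sub>u) \<partial>\<^sub>v = a\<^sup>2 t / (f\<^sup>2 + a\<^sup>2) \<partial>\<^sub>u\<close>;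
  the difference is \<open>- t \<partial>\<^sub>u\<close>. In the direction \<open>x\<close> the curvature term vanishes, as both
  arguments of \<open>R\<close> are multiples of \<open>\<partial>\<^sub>u\<close>.
\<close>

lemma bitension_rotational:
  fixes p :: "real^2" and \<phi> :: "real^2 \<Rightarrow> real^2"
  assumes "a \<noteq> 0"
    and \<phi>: "\<phi> = (\<lambda>p. vector [f (p $ 1), p $ 2])"
    and f: "\<And>x. (f has_real_derivative f' x) (at x)"
    and tension: "tension standard_metric (induced_metric (helicoid a)) \<phi> =
      (\<lambda>p. vector [t (p $ 1), 0])"
    and t: "\<And>x. (t has_real_derivative t' x) (at x)"
    and t': "\<And>x. (t' has_real_derivative t'' x) (at x)"
  shows "bitension standard_metric (induced_metric (helicoid a)) \<phi> p =
    vector [t'' (p $ 1) - t (p $ 1), 0]"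
proof -
  let ?h = "induced_metric (helicoid a)"
  let ?\<tau> = "tension standard_metric ?h \<phi>"
  let ?k = "\<lambda>x. f x / ((f x)\<^sup>2 + a\<^sup>2)"
  note conn = pullback_connection_rotational[OF assms(1) \<phi> f]
  have pos: "(f x)\<^sup>2 + a\<^sup>2 > 0" for x
    using sum_square_pos[OF assms(1)] .
  have d\<phi>: "differential \<phi> q = (\<lambda>w. vector [f' (q $ 1) * w $ 1, w $ 2])" for q
    by (rule differential_rotational[OF \<phi> f])
  have zero: "pullback_connection ?h \<phi> (\<lambda>_. 0) ?\<tau> p = 0"
    using conn[OF t DERIV_const[of 0], of "\<lambda>_. 0" p] by (simp add: tension vec_eq_iff forall_2)
  have "pullback_connection ?h \<phi> (coord_field 1) ?\<tau> = (\<lambda>q. vector [t' (q $ 1), 0])"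
    using conn[OF t DERIV_const[of 0], of "coord_field 1"]
    by (simp add: tension fun_eq_iff coord_field_nth)
  then have xx: "pullback_connection ?h \<phi> (coord_field 1)
      (pullback_connection ?h \<phi> (coord_field 1) ?\<tau>) p = vector [t'' (p $ 1), 0]"
    using conn[OF t' DERIV_const[of 0], of "coord_field 1" p] by (simp add: coord_field_nth)
  have y: "pullback_connection ?h \<phi> (coord_field 2) ?\<tau> =
      (\<lambda>q. vector [0, ?k (q $ 1) * t (q $ 1)])"
    using conn[OF t DERIV_const[of 0], of "coord_field 2"]
    by (simp add: tension fun_eq_iff coord_field_nth)
  obtain d where d: "((\<lambda>x. ?k x * t x) has_real_derivative d) (at (p $ 1))"
  proof -
    have "((\<lambda>u. u / (u\<^sup>2 + a\<^sup>2)) \<circ> f has_real_derivative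
        (a\<^sup>2 - (f (p $ 1))\<^sup>2) / ((f (p $ 1))\<^sup>2 + a\<^sup>2)\<^sup>2 * f' (p $ 1)) (at (p $ 1))"
      by (intro DERIV_chain has_real_derivative_connection_coefficient assms(1) f)
    from DERIV_mult[OF this t] that show ?thesis
      by (auto simp: o_def)
  qed
  have yy: "pullback_connection ?h \<phi> (coord_field 2)
      (pullback_connection ?h \<phi> (coord_field 2) ?\<tau>) p =
      vector [- (f (p $ 1) * (?k (p $ 1) * t (p $ 1))), 0]"
    using conn[OF DERIV_const[of 0] d, of "coord_field 2"] by (simp add: y coord_field_nth)
  have Rx: "curvature_at ?h (\<phi> p) (differential \<phi> p (coord_field 1 p)) (?\<tau> p)
      (differential \<phi> p (coord_field 1 p)) = 0"
    by (simp add: curvature_at_helicoid[OF assms(1)] d\<phi> tension coord_field_nth vec_eq_iff forall_2)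
  have \<phi>p: "\<phi> p $ 1 = f (p $ 1)"
    by (simp add: \<phi>)
  have Ry: "curvature_at ?h (\<phi> p) (differential \<phi> p (coord_field 2 p)) (?\<tau> p)
      (differential \<phi> p (coord_field 2 p)) =
      vector [a\<^sup>2 * t (p $ 1) / ((f (p $ 1))\<^sup>2 + a\<^sup>2), 0]"
    using pos[of "p $ 1"] \<phi>p
    by (simp add: curvature_at_helicoid[OF assms(1)] d\<phi> tension coord_field_nth vec_eq_iff
        forall_2 power2_eq_square)
  have "- (f x * (?k x * t x)) - a\<^sup>2 * t x / ((f x)\<^sup>2 + a\<^sup>2) = - t x" for x
    using pos[of x] assms(1) by (simp add: divide_simps) (simp add: algebra_simps power2_eq_square)
  from this[of "p $ 1"] show ?thesis
    by (simp add: bitension_def metric_trace_standard sum_2 levi_civita_standard_coord_field zero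
        xx yy Rx Ry vec_eq_iff forall_2)
qed

section \<open>The differential equation\<close>

text \<open>
  \<open>(g + g') e\<^sup>-\<^sup>x\<close> and \<open>(g - g') e\<^sup>x\<close> are first integrals of \<open>g'' = g\<close>.
\<close>

lemma exp_solutions:
  fixes g g' :: "real \<Rightarrow> real"
  assumes g: "\<And>x. (g has_real_derivative g' x) (at x)"
    and g': "\<And>x. (g' has_real_derivative g x) (at x)"
  obtains P Q where "\<And>x. g x = P * exp x + Q * exp (- x)"
proof -
  have "((\<lambda>x. (g x + g' x) * exp (- x)) has_real_derivative 0) (at x)" for x
    by (auto intro!: derivative_eq_intros g g' simp: algebra_simps)
  from DERIV_isconst_all[OF allI[OF this]]
  have P: "(g x + g' x) * exp (- x) = g 0 + g' 0" for x
    by (metis exp_zero minus_zero mult.right_neutral)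
  have "((\<lambda>x. (g x - g' x) * exp x) has_real_derivative 0) (at x)" for x
    by (auto intro!: derivative_eq_intros g g' simp: algebra_simps)
  from DERIV_isconst_all[OF allI[OF this]]
  have Q: "(g x - g' x) * exp x = g 0 - g' 0" for x
    by (metis exp_zero mult.right_neutral)
  have "g x = (g 0 + g' 0) / 2 * exp x + (g 0 - g' 0) / 2 * exp (- x)" for x
  proof -
    have "g x + g' x = (g 0 + g' 0) * exp x" "g x - g' x = (g 0 - g' 0) * exp (- x)"
      using P[of x] Q[of x] by (simp_all add: exp_minus field_simps)
    then show ?thesis
      by (simp add: field_simps)
  qed
  then show ?thesis
    by (rule that)
qed

text \<open>
  By the previous lemma \<open>f'' - f = P e\<^sup>x + Q e\<^sup>-\<^sup>x\<close>. Since \<open>g \<mapsto> g'' - g\<close> maps \<open>x e\<^sup>x\<close> to \<open>2 e\<^sup>x\<close> and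
  \<open>x e\<^sup>-\<^sup>x\<close> to \<open>- 2 e\<^sup>-\<^sup>x\<close>, subtracting \<open>P/2 \<cdot> x e\<^sup>x - Q/2 \<cdot> x e\<^sup>-\<^sup>x\<close> from \<open>f\<close> leaves a solution of
  the same homogeneous equation.
\<close>

lemma iterated_exp_solutions:
  fixes f f' f'' t' :: "real \<Rightarrow> real"
  assumes f: "\<And>x. (f has_real_derivative f' x) (at x)"
    and f': "\<And>x. (f' has_real_derivative f'' x) (at x)"
    and t: "\<And>x. ((\<lambda>x. f'' x - f x) has_real_derivative t' x) (at x)"
    and t': "\<And>x. (t' has_real_derivative f'' x - f x) (at x)"
  shows "\<exists>A B C D. \<forall>x. f x = (A + B * x) * exp x + (C + D * x) * exp (- x)"
proof -
  obtain P Q where PQ: "f'' x - f x = P * exp x + Q * exp (- x)" for x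
    using exp_solutions[OF t t'] by metis
  define B D where "B = P / 2" and "D = - Q / 2"
  have f'': "f'' x = f x + 2 * B * exp x - 2 * D * exp (- x)" for x
    using PQ[of x] by (simp add: B_def D_def)
  let ?g = "\<lambda>x. f x - B * x * exp x - D * x * exp (- x)"
  let ?g' = "\<lambda>x. f' x - B * (1 + x) * exp x - D * (1 - x) * exp (- x)"
  have g: "(?g has_real_derivative ?g' x) (at x)" for x
    by (auto intro!: derivative_eq_intros f simp: algebra_simps)
  have g': "(?g' has_real_derivative ?g x) (at x)" for x
    by (auto intro!: derivative_eq_intros f' simp: f'' algebra_simps)
  obtain A C where AC: "?g x = A * exp x + C * exp (- x)" for x
    by (rule exp_solutions[OF g g']) (rule that)
  have "f x = (A + B * x) * exp x + (C + D * x) * exp (- x)" for x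
    using AC[of x] by (simp add: algebra_simps)
  then show ?thesis
    by blast
qed

lemma deriv_deriv_exp_affine:
  fixes A B C D :: real
  shows "deriv (deriv (\<lambda>x. (A + B * x) * exp x + (C + D * x) * exp (- x))) =
    (\<lambda>x. ((A + 2 * B) + B * x) * exp x + ((C - 2 * D) + D * x) * exp (- x))"
proof -
  have "deriv (\<lambda>x. (A + B * x) * exp x + (C + D * x) * exp (- x)) =
      (\<lambda>x. (A + B + B * x) * exp x + (D - C - D * x) * exp (- x))" for A B C D :: real
    by (rule ext, rule DERIV_imp_deriv)
      (auto intro!: derivative_eq_intros simp: algebra_simps)
  from this[of A B C D] this[of "A + B" B "D - C" "- D"] show ?thesis
    by (simp add: algebra_simps)
qed

lemma exp_independent:
  fixes B D :: real
  assumes "\<And>x. B * exp x = D * exp (- x)"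
  shows "B = 0 \<and> D = 0"
proof -
  have "B = D"
    using assms[of 0] by simp
  moreover have "exp (1::real) \<noteq> exp (- 1)"
    by simp
  ultimately show ?thesis
    using assms[of 1] by auto
qed

section \<open>Biharmonic maps into the helicoid\<close>

theorem corollary3p3:
  fixes a :: real and f :: "real \<Rightarrow> real" and \<phi> :: "real^2 \<Rightarrow> real^2"
  assumes "a \<noteq> 0"
    and "smooth_real f"
    and "\<And>p. \<phi> p = vector [f (p $ 1), p $ 2]"
  shows "(biharmonic_map standard_metric (induced_metric (helicoid a)) \<phi> \<longleftrightarrow>
            (\<exists>A B C D :: real. \<forall>x. f x = (A + B * x) * exp x + (C + D * x) * exp (- x))) \<and>
         (\<forall>A B C D :: real.
            (\<forall>x. f x = (A + B * x) * exp x + (C + D * x) * exp (- x)) \<longrightarrow> B\<^sup>2 + D\<^sup>2 \<noteq> 0 \<longrightarrow>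
            proper_biharmonic_map standard_metric (induced_metric (helicoid a)) \<phi>)"
proof -
  let ?h = "induced_metric (helicoid a)"
  define d where "d n = (deriv ^^ n) f" for n
  have d0: "d 0 = f" and dSuc: "d (Suc n) = deriv (d n)" for n
    by (simp_all add: d_def)
  have der: "(d n has_real_derivative d (Suc n) x) (at x)" for n x
    using assms(2) unfolding smooth_real_def d_def
    by (simp add: differentiable_on_def DERIV_deriv_iff_real_differentiable)
  note f = der[of 0, unfolded d0]
  have \<phi>: "\<phi> = (\<lambda>p. vector [f (p $ 1), p $ 2])"
    using assms(3) by (rule ext)
  have ten: "tension standard_metric ?h \<phi> = (\<lambda>p. vector [d 2 (p $ 1) - f (p $ 1), 0])"
    using tension_rotational[OF assms(1) \<phi> f der] by (simp add: numeral_2_eq_2)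
  have t: "((\<lambda>x. d 2 x - f x) has_real_derivative d 3 x - d 1 x) (at x)" for x
    using DERIV_diff[OF der[of 2] der[of 0]] by (simp add: d0)
  have t': "((\<lambda>x. d 3 x - d 1 x) has_real_derivative d 4 x - d 2 x) (at x)" for x
    using DERIV_diff[OF der[of 3] der[of 1]] by (simp add: numeral_2_eq_2)
  have biten: "bitension standard_metric ?h \<phi> p =
      vector [(d 4 (p $ 1) - d 2 (p $ 1)) - (d 2 (p $ 1) - f (p $ 1)), 0]" for p
    by (rule bitension_rotational[OF assms(1) \<phi> f ten t t'])
  have all_fst: "(\<forall>p::real^2. R (p $ 1)) \<longleftrightarrow> (\<forall>x. R x)" for R :: "real \<Rightarrow> bool"
    by (metis vector_2(1))
  have bih: "biharmonic_map standard_metric ?h \<phi> \<longleftrightarrow> (\<forall>x. d 4 x - d 2 x = d 2 x - f x)"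
    by (subst all_fst[symmetric]) (simp add: biharmonic_map_def biten vec_eq_iff forall_2 algebra_simps)
  have harm: "harmonic_map standard_metric ?h \<phi> \<longleftrightarrow> (\<forall>x. d 2 x = f x)"
    by (subst all_fst[symmetric]) (simp add: harmonic_map_def ten vec_eq_iff forall_2)
  have sol: "\<exists>A B C D. \<forall>x. f x = (A + B * x) * exp x + (C + D * x) * exp (- x)"
    if "biharmonic_map standard_metric ?h \<phi>"
  proof (rule iterated_exp_solutions[OF f _ t])
    show "(d (Suc 0) has_real_derivative d 2 x) (at x)" for x
      using der[of 1 x] by (simp add: numeral_2_eq_2)
    show "((\<lambda>x. d 3 x - d 1 x) has_real_derivative d 2 x - f x) (at x)" for x
      using t'[of x] that by (simp add: bih)
  qed
  have explicit: "biharmonic_map standard_metric ?h \<phi> \<and>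
      (\<forall>x. d 2 x - f x = 2 * B * exp x - 2 * D * exp (- x))"
    if "\<forall>x. f x = (A + B * x) * exp x + (C + D * x) * exp (- x)" for A B C D
  proof -
    have "f = (\<lambda>x. (A + B * x) * exp x + (C + D * x) * exp (- x))"
      using that by auto
    then have d2: "d 2 = (\<lambda>x. ((A + 2 * B) + B * x) * exp x + ((C - 2 * D) + D * x) * exp (- x))"
      by (simp only: d0 dSuc numeral_2_eq_2 deriv_deriv_exp_affine)
    have "d 4 = deriv (deriv (d 2))"
      by (simp add: dSuc numeral_eq_Suc)
    then have "d 4 = (\<lambda>x. ((A + 2 * B + 2 * B) + B * x) * exp x
        + ((C - 2 * D - 2 * D) + D * x) * exp (- x))"
      by (simp only: d2 deriv_deriv_exp_affine)
    with that d2 show ?thesis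
      by (simp add: bih algebra_simps)
  qed
  have "\<not> harmonic_map standard_metric ?h \<phi>"
    if f_eq: "\<forall>x. f x = (A + B * x) * exp x + (C + D * x) * exp (- x)"
      and "B\<^sup>2 + D\<^sup>2 \<noteq> 0" for A B C D
  proof
    assume "harmonic_map standard_metric ?h \<phi>"
    then have "B * exp x = D * exp (- x)" for x
      using explicit[OF f_eq] by (simp add: harm)
    then show False
      using exp_independent[of B D] that(2) by auto
  qed
  with sol explicit show ?thesis
    unfolding proper_biharmonic_map_def by blast
qed

end
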